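(* Let $n\ge 3$. Given an initial polygon $X^0$ with $n$ vertices in $\mathbb{R}^2$ and any $m\in\mathbb{N}$ (a strictly positive integer), the equation $$\frac{dX}{dt}=(-1)^{m+1}M^mX$$ with initial data $X(0)=X^0$ has a unique solution given by $$X(t)=a_0(0)P_0+\sum_{k=1}^{n-1}a_k(0)e^{\lambda_{m,k}t}P_k .$$ The solution exists for all time and converges exponentially to a point. Under appropriate rescaling, the solution is asymptotic as $t\to\infty$ to an affine transformation of a regular polygon with $n$ vertices.
   Context: A closed $n$-gon (polygon with $n$ vertices) in the plane is an ordered tuple $X=(X_0,\dots,X_{n-1})^T$ of points of $\mathbb{R}^2$, identified with a vector in $\mathbb{C}^n$ by $(x,y)\mapsto x+iy$; indices are taken modulo $n$. $M$ is the $n\times n$ circulant matrix with $-2$ on the diagonal, $1$ in positions $(j,j\pm1)$ (indices modulo $n$), and $0$ elsewhere, so $(MX)_j=X_{j+1}-2X_j+X_{j-1}$. With $\omega=e^{2\pi i/n}$, $P_k=(1,\omega^k,\omega^{2k},\dots,\omega^{(n-1)k})^T\in\mathbb{C}^n$ for $k=0,\dots,n-1$; these vectors form a basis of $\mathbb{C}^n$, and the complex numbers $a_k(0)$ are the coefficients of the initial polygon in this basis, $X^0=\sum_{k=0}^{n-1}a_k(0)P_k$. $\lambda_{m,k}=(-1)^{m+1}\left(-4\sin^2(\pi k/n)\right)^m$ is the eigenvalue of $(-1)^{m+1}M^m$ for the eigenvector $P_k$.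
   Formalization: The affine transformation may be singular, since an invertible one need not exist (n=4, X^0=P_2); it is shown invertible when |a_1(0)|≠|a_{n-1}(0)| and nonconstant unless a_1(0)=a_{n-1}(0)=0. The rescaling is by e^{-λ_{m,1}t} about the limit point. *)

theory Defs
  imports Complex_Main "Jordan_Normal_Form.Matrix"
begin

text \<open>
  A closed \<open>n\<close>-gon is its vector of vertices, an element of \<^term>\<open>carrier_vec n\<close> over the
  complex numbers, the plane being identified with \<^typ>\<open>complex\<close>.
\<close>

type_synonym polygon = "complex vec"

text \<open>
  The three cases below are disjoint and every row has exactly two entries \<open>1\<close> only for
  \<open>n \<ge> 3\<close>.
\<close>

definition polygon_matrix :: "nat \<Rightarrow> complex mat" where
  "polygon_matrix n = mat n n (\<lambda>(i, j).
     if i = j then -2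
     else if j = (i + 1) mod n \<or> i = (j + 1) mod n then 1
     else 0)"

definition basis_polygon :: "nat \<Rightarrow> nat \<Rightarrow> polygon" where
  "basis_polygon n k = vec n (\<lambda>j. exp (2 * complex_of_real pi * \<i> / of_nat n) ^ (j * k))"

text \<open>
  The coefficient vector is specified by its defining property; that it exists and is unique
  for \<open>X \<in> carrier_vec n\<close> is the statement that the basis polygons form a basis.
\<close>

definition polygon_coeffs :: "nat \<Rightarrow> polygon \<Rightarrow> complex vec" where
  "polygon_coeffs n X = (THE a. a \<in> carrier_vec n \<and>
     X = finsum_vec TYPE(complex) n (\<lambda>k. (a $ k) \<cdot>\<^sub>v basis_polygon n k) {0..<n})"

definition flow_eigenvalue :: "nat \<Rightarrow> nat \<Rightarrow> nat \<Rightarrow> real" where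
  "flow_eigenvalue n m k = (-1) ^ (m + 1) * (- 4 * (sin (pi * real k / real n))\<^sup>2) ^ m"

text \<open>
  \<open>X\<close> solves the system on the set \<open>I\<close> of times with \<open>X(0) = X0\<close>. The derivative of the
  vector-valued function is taken entrywise, and is one-sided at end points of \<open>I\<close> in \<open>I\<close>.
\<close>

definition polygon_flow ::
  "nat \<Rightarrow> nat \<Rightarrow> polygon \<Rightarrow> real set \<Rightarrow> (real \<Rightarrow> polygon) \<Rightarrow> bool" where
  "polygon_flow n m X0 I X \<longleftrightarrow>
     X 0 = X0 \<and>
     (\<forall>t\<in>I. X t \<in> carrier_vec n \<and>
       (\<forall>j<n. ((\<lambda>s. X s $ j) has_vector_derivative
          ((((-1) ^ (m + 1) \<cdot>\<^sub>m (polygon_matrix n ^\<^sub>m m)) *\<^sub>v X t) $ j)) (at t within I)))"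

definition flow_solution :: "nat \<Rightarrow> nat \<Rightarrow> polygon \<Rightarrow> real \<Rightarrow> polygon" where
  "flow_solution n m X0 t =
     (polygon_coeffs n X0 $ 0) \<cdot>\<^sub>v basis_polygon n 0 +
     finsum_vec TYPE(complex) n
       (\<lambda>k. (polygon_coeffs n X0 $ k * of_real (exp (flow_eigenvalue n m k * t))) \<cdot>\<^sub>v
            basis_polygon n k) {1..<n}"

text \<open>
  The vertices are equally spaced on a circle of positive radius and are listed in cyclic
  order, with either orientation; star polygons and multiply traversed polygons are excluded.
\<close>

definition regular_polygon :: "nat \<Rightarrow> polygon \<Rightarrow> bool" where
  "regular_polygon n R \<longleftrightarrow> R \<in> carrier_vec n \<and>
     (\<exists>c r s. r \<noteq> 0 \<and> s \<in> {1, -1} \<and>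
        (\<forall>j<n. R $ j = c + r * cis (s * (2 * pi * real j / real n))))"

text \<open>
  Affine over the reals; the linear part is allowed to be singular.
\<close>

definition affine_transformation :: "(complex \<Rightarrow> complex) \<Rightarrow> bool" where
  "affine_transformation A \<longleftrightarrow> (\<exists>L c. linear L \<and> A = (\<lambda>z. L z + c))"

end

theory Submission
  imports "HOL-Analysis.Derivative" Defs
begin

text \<open>
  The basis polygons are orthogonal eigenvectors of the circulant matrix, so the Fourier
  coefficients of any solution satisfy decoupled scalar equations \<open>a' = \<lambda> a\<close>; this gives both
  existence and uniqueness. Apart from the constant mode, the slowest decay rate is attained
  exactly for \<open>k = 1\<close> and \<open>k = n - 1\<close>. As \<open>P\<^sub>n\<^sub>-\<^sub>1\<close> is the complex conjugate of \<open>P\<^sub>1\<close>, the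
  rescaled limit is the image of the regular polygon \<open>P\<^sub>1\<close> under the real-linear map
  \<open>z \<mapsto> a\<^sub>1 z + a\<^sub>n\<^sub>-\<^sub>1 cnj z\<close>.
\<close>

unbundle no vec_syntax

section \<open>The discrete Fourier basis\<close>

lemma sum_powers_root_of_unity:
  fixes q :: complex
  assumes "q ^ n = 1" "q \<noteq> 1"
  shows "(\<Sum>j<n. q ^ j) = 0"
  using assms geometric_sum[of q n] by simp

lemma power_mod_root_of_unity:
  fixes q :: complex
  assumes "q ^ n = 1"
  shows "q ^ (a mod n) = q ^ a"
proof -
  have "q ^ a = q ^ (n * (a div n) + a mod n)" by simp
  also have "\<dots> = q ^ (a mod n)" by (simp only: power_add power_mult assms) simp
  finally show ?thesis ..
qed

lemma basis_polygon_carrier [simp]: "basis_polygon n k \<in> carrier_vec n"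
  by (simp add: basis_polygon_def)

lemma basis_polygon_dim [simp]: "dim_vec (basis_polygon n k) = n"
  by (simp add: basis_polygon_def)

text \<open>Each entry is a power of one root of unity depending only on \<open>k\<close>, so that
  sums over \<open>j\<close> become geometric sums.\<close>

lemma basis_polygon_index:
  assumes "j < n"
  shows "basis_polygon n k $ j = cis (2 * pi * real k / real n) ^ j"
proof -
  have e: "exp (2 * complex_of_real pi * \<i> / of_nat n) = cis (2 * pi / real n)"
    by (simp add: cis_conv_exp mult_ac)
  show ?thesis
    using assms unfolding basis_polygon_def e DeMoivre by (simp add: mult_ac)
qed

text \<open>Symmetry of the Fourier matrix lets orthogonality of its columns serve for its rows in
  \<open>fourier_inversion\<close>.\<close>

lemma basis_polygon_sym:
  assumes "j < n" "k < n"
  shows "basis_polygon n k $ j = basis_polygon n j $ k"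
  using assms by (simp add: basis_polygon_def mult.commute)

lemma basis_polygon_0: "j < n \<Longrightarrow> basis_polygon n 0 $ j = 1"
  by (simp add: basis_polygon_def)

lemma norm_basis_polygon: "j < n \<Longrightarrow> norm (basis_polygon n k $ j) = 1"
  by (simp add: basis_polygon_index norm_power)

text \<open>The summands are powers of a single \<open>n\<close>-th root of unity \<open>q\<close>,
  the quotient of those belonging to \<open>k\<close> and \<open>l\<close>. It equals 1 only for
  \<open>k = l\<close>; otherwise the geometric sum vanishes.\<close>

lemma basis_polygon_orthogonal:
  assumes k: "k < n" and l: "l < n"
  shows "(\<Sum>j<n. basis_polygon n k $ j * cnj (basis_polygon n l $ j)) =
    (if k = l then of_nat n else 0)"
proof -
  define z where "z i = cis (2 * pi * real i / real n)" for i
  define q where "q = z k * cnj (z l)"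
  have n: "0 < n" using k by simp
  have "z i ^ n = 1" for i
    using n by (simp add: z_def DeMoivre cis_multiple_2pi)
  hence "q ^ n = 1" by (simp add: q_def power_mult_distrib flip: complex_cnj_power)
  have zz: "z i * cnj (z i) = 1" for i
    by (simp add: z_def cis_cnj cis_mult)
  have "k = l" if "q = 1"
  proof -
    have "z k = q * z l" using zz[of l] by (simp add: q_def mult_ac)
    hence "z k = z l" using that by simp
    thus ?thesis
      using bij_betw_roots_unity[OF n] k l by (auto simp: z_def bij_betw_def inj_on_def mult_ac)
  qed
  moreover have "(\<Sum>j<n. basis_polygon n k $ j * cnj (basis_polygon n l $ j)) = (\<Sum>j<n. q ^ j)"
    by (rule sum.cong) (simp_all add: basis_polygon_index q_def z_def power_mult_distrib)
  ultimately show ?thesis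
    using sum_powers_root_of_unity[OF \<open>q ^ n = 1\<close>] zz[of k] by (auto simp: q_def)
qed

text \<open>The inner product with the \<open>k\<close>-th basis polygon, divided by its squared
  norm \<open>n\<close>: a closed formula to replace the \<open>THE\<close> in
  \<open>polygon_coeffs\<close>.\<close>

definition fourier_coeff :: "nat \<Rightarrow> polygon \<Rightarrow> nat \<Rightarrow> complex" where
  "fourier_coeff n X k = (\<Sum>j<n. X $ j * cnj (basis_polygon n k $ j)) / of_nat n"

text \<open>Pairing with the \<open>k\<close>-th basis polygon removes all other terms. This is
  uniqueness of coefficients, used again to read off the coefficients of the generator's
  image.\<close>

lemma fourier_coeff_expansion:
  assumes "\<And>j. j < n \<Longrightarrow> X $ j = (\<Sum>k<n. c k * basis_polygon n k $ j)" and k: "k < n"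
  shows "fourier_coeff n X k = c k"
proof -
  have "(\<Sum>j<n. X $ j * cnj (basis_polygon n k $ j)) =
      (\<Sum>j<n. \<Sum>l<n. c l * (basis_polygon n l $ j * cnj (basis_polygon n k $ j)))"
    by (rule sum.cong) (simp_all add: assms(1) sum_distrib_right mult.assoc)
  also have "\<dots> = (\<Sum>l<n. c l * (\<Sum>j<n. basis_polygon n l $ j * cnj (basis_polygon n k $ j)))"
    by (subst sum.swap) (simp add: sum_distrib_left)
  also have "\<dots> = (\<Sum>l<n. if l = k then c l * of_nat n else 0)"
    by (rule sum.cong) (use k in \<open>simp_all add: basis_polygon_orthogonal\<close>)
  also have "\<dots> = c k * of_nat n" using k by simp
  finally show ?thesis using k by (simp add: fourier_coeff_def)
qed

text \<open>After the sums are swapped, symmetry turns the inner sum over frequencies into the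
  orthogonality relation of the basis polygons with indices \<open>j\<close> and
  \<open>i\<close>.\<close>

lemma fourier_inversion:
  assumes j: "j < n"
  shows "X $ j = (\<Sum>k<n. fourier_coeff n X k * basis_polygon n k $ j)"
proof -
  have "fourier_coeff n X k * basis_polygon n k $ j =
      (\<Sum>i<n. X $ i / of_nat n * (basis_polygon n j $ k * cnj (basis_polygon n i $ k)))"
    if k: "k < n" for k
    unfolding fourier_coeff_def sum_divide_distrib sum_distrib_right basis_polygon_sym[OF j k]
    by (rule sum.cong) (simp_all add: basis_polygon_sym[OF _ k])
  hence "(\<Sum>k<n. fourier_coeff n X k * basis_polygon n k $ j) =
     (\<Sum>k<n. \<Sum>i<n. X $ i / of_nat n * (basis_polygon n j $ k * cnj (basis_polygon n i $ k)))"
    by simp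
  also have "\<dots> = (\<Sum>i<n. X $ i / of_nat n *
      (\<Sum>k<n. basis_polygon n j $ k * cnj (basis_polygon n i $ k)))"
    by (subst sum.swap) (simp add: sum_distrib_left)
  also have "\<dots> = (\<Sum>i<n. if i = j then X $ i else 0)"
    by (rule sum.cong) (use j in \<open>simp_all add: basis_polygon_orthogonal\<close>)
  also have "\<dots> = X $ j" using j by simp
  finally show ?thesis ..
qed

lemma index_finsum_basis_polygon:
  assumes "finite F" "j < n"
  shows "finsum_vec TYPE(complex) n (\<lambda>k. c k \<cdot>\<^sub>v basis_polygon n k) F $ j =
    (\<Sum>k\<in>F. c k * basis_polygon n k $ j)"
  using assms by (subst index_finsum_vec) auto

lemma finsum_basis_polygon_carrier:
  "finsum_vec TYPE(complex) n (\<lambda>k. c k \<cdot>\<^sub>v basis_polygon n k) F \<in> carrier_vec n"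
  by (rule finsum_vec_closed) auto

lemma polygon_coeffs_eq:
  assumes X: "X \<in> carrier_vec n"
  shows "polygon_coeffs n X = vec n (fourier_coeff n X)"
  unfolding polygon_coeffs_def
proof (rule the_equality)
  let ?S = "\<lambda>a. finsum_vec TYPE(complex) n (\<lambda>k. (a $ k) \<cdot>\<^sub>v basis_polygon n k) {0..<n}"
  have "X = ?S (vec n (fourier_coeff n X))"
  proof (rule eq_vecI)
    fix j assume "j < dim_vec (?S (vec n (fourier_coeff n X)))"
    hence j: "j < n" using finsum_basis_polygon_carrier by (metis carrier_vecD)
    show "X $ j = ?S (vec n (fourier_coeff n X)) $ j"
      using j fourier_inversion[OF j, of X]
      by (simp add: index_finsum_basis_polygon atLeast0LessThan)
  qed (use X finsum_basis_polygon_carrier in \<open>metis carrier_vecD\<close>)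
  thus "vec n (fourier_coeff n X) \<in> carrier_vec n \<and> X = ?S (vec n (fourier_coeff n X))"
    by simp
next
  fix a assume a: "a \<in> carrier_vec n \<and>
    X = finsum_vec TYPE(complex) n (\<lambda>k. (a $ k) \<cdot>\<^sub>v basis_polygon n k) {0..<n}"
  have "X $ j = (\<Sum>k<n. a $ k * basis_polygon n k $ j)" if "j < n" for j
    using a that index_finsum_basis_polygon[of "{0..<n}" j n "\<lambda>k. a $ k"]
    by (simp add: atLeast0LessThan)
  hence "fourier_coeff n X k = a $ k" if "k < n" for k
    using fourier_coeff_expansion[of n X "\<lambda>k. a $ k"] that by blast
  thus "a = vec n (fourier_coeff n X)" using a by (intro eq_vecI) auto
qed

section \<open>The spectrum of the flow\<close>

lemma polygon_matrix_carrier [simp]: "polygon_matrix n \<in> carrier_mat n n"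
  by (simp add: polygon_matrix_def)

text \<open>Additive indicators let a matrix row act as three one-term sums. For
  \<open>n \<ge> 3\<close> the two neighbours of \<open>i\<close> are distinct, so the indicators
  never overlap. Writing the predecessor as \<open>i + (n - 1)\<close> avoids truncated subtraction
  at \<open>i = 0\<close>.\<close>

lemma polygon_matrix_index:
  assumes "n \<ge> 3" "i < n" "j < n"
  shows "polygon_matrix n $$ (i, j) = (if j = i then -2 else 0) +
    (if j = (i + 1) mod n then 1 else 0) + (if j = (i + (n - 1)) mod n then 1 else 0)"
proof -
  have pred: "(i + (n - 1)) mod n = (if i = 0 then n - 1 else i - 1)"
    using assms by (auto simp: mod_if)
  have succ: "(a + 1) mod n = (if a = n - 1 then 0 else a + 1)" if "a < n" for a
    using assms that by (auto simp: mod_if)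
  have "polygon_matrix n $$ (i, j) =
      (if i = j then -2 else if j = (i + 1) mod n \<or> i = (j + 1) mod n then 1 else 0)"
    using assms by (simp add: polygon_matrix_def)
  thus ?thesis
    unfolding pred succ[OF assms(2)] succ[OF assms(3)] using assms
    by (cases "i = 0"; cases "i = n - 1"; cases "j = 0"; cases "j = n - 1") auto
qed

text \<open>Cyclic shifts multiply the basis polygon by \<open>?z\<close> or its inverse, so the
  eigenvalue is \<open>-2 + ?z + cnj ?z\<close>, that is \<open>2 * cos x - 2\<close> with
  \<open>x\<close> the angle of \<open>?z\<close>; the double-angle formula gives the sine
  form.\<close>

lemma polygon_matrix_eigen:
  assumes n: "n \<ge> 3"
  shows "polygon_matrix n *\<^sub>v basis_polygon n k =
    of_real (- 4 * (sin (pi * real k / real n))\<^sup>2) \<cdot>\<^sub>v basis_polygon n k"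
proof (rule eq_vecI)
  let ?z = "cis (2 * pi * real k / real n)"
  let ?v = "\<lambda>j. basis_polygon n k $ j"
  let ?\<mu> = "- 4 * (sin (pi * real k / real n))\<^sup>2"
  have zn: "?z ^ n = 1" using n by (simp add: DeMoivre cis_multiple_2pi)
  \<comment> \<open>Since \<open>?z ^ n = 1\<close>, the wrap-around at both ends of the polygon
    needs no case distinction.\<close>
  have v_mod: "?v (a mod n) = ?z ^ a" for a
    using n by (simp add: basis_polygon_index power_mod_root_of_unity[OF zn])
  fix i assume "i < dim_vec (of_real ?\<mu> \<cdot>\<^sub>v basis_polygon n k)"
  hence i: "i < n" by simp
  have "(polygon_matrix n *\<^sub>v basis_polygon n k) $ i =
      (\<Sum>j\<in>{0..<n}. polygon_matrix n $$ (i, j) * ?v j)"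
    using i by (simp add: scalar_prod_def polygon_matrix_def)
  also have "\<dots> = (\<Sum>j\<in>{0..<n}. (if j = i then - 2 * ?v j else 0) +
      (if j = (i + 1) mod n then ?v j else 0) + (if j = (i + (n - 1)) mod n then ?v j else 0))"
    by (rule sum.cong) (use n i in \<open>simp_all add: polygon_matrix_index distrib_right\<close>)
  also have "\<dots> = - 2 * ?v i + ?v ((i + 1) mod n) + ?v ((i + (n - 1)) mod n)"
    using n i by (simp add: sum.distrib)
  also have "\<dots> = ?z ^ i * (- 2 + ?z + ?z ^ (n - 1))"
    unfolding basis_polygon_index[OF i] v_mod power_add
    by (simp only: distrib_left mult.commute[of "-2"] power_one_right)
  also have "?z ^ (n - 1) = cnj ?z"
  proof -
    have "?z * ?z ^ (n - 1) = ?z * cnj ?z"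
      using zn n by (simp add: cis_cnj cis_mult flip: power_Suc)
    thus ?thesis by simp
  qed
  also have "- 2 + ?z + cnj ?z = of_real ?\<mu>"
    using cos_double_sin[of "pi * real k / real n"]
    by (simp add: complex_eq_iff mult_ac)
  finally show "(polygon_matrix n *\<^sub>v basis_polygon n k) $ i =
      (of_real ?\<mu> \<cdot>\<^sub>v basis_polygon n k) $ i"
    using i by (simp only: index_smult_vec basis_polygon_dim basis_polygon_index mult.commute)
qed (simp add: polygon_matrix_def)

lemma polygon_matrix_pow_eigen:
  assumes n: "n \<ge> 3"
  shows "polygon_matrix n ^\<^sub>m m *\<^sub>v basis_polygon n k =
    of_real (- 4 * (sin (pi * real k / real n))\<^sup>2) ^ m \<cdot>\<^sub>v basis_polygon n k"
proof (induction m)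
  case 0
  have "dim_row (polygon_matrix n) = n" by (simp add: polygon_matrix_def)
  thus ?case by simp
next
  case (Suc m)
  have "polygon_matrix n ^\<^sub>m Suc m *\<^sub>v basis_polygon n k =
      polygon_matrix n ^\<^sub>m m *\<^sub>v (polygon_matrix n *\<^sub>v basis_polygon n k)"
    by (simp add: assoc_mult_mat_vec[of _ n n _ n])
  thus ?case
    by (simp add: polygon_matrix_eigen[OF n] mult_mat_vec[of _ n n] Suc.IH smult_smult_assoc)
qed

text \<open>The coefficients \<open>c\<close> are left free: existence uses those of the explicit
  solution, uniqueness the Fourier coefficients of an arbitrary one.\<close>

lemma flow_generator_expansion:
  assumes n: "n \<ge> 3" and X: "X \<in> carrier_vec n" and j: "j < n"
    and exp: "\<And>i. i < n \<Longrightarrow> X $ i = (\<Sum>k<n. c k * basis_polygon n k $ i)"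
  shows "(((-1) ^ (m + 1) \<cdot>\<^sub>m (polygon_matrix n ^\<^sub>m m)) *\<^sub>v X) $ j =
    (\<Sum>k<n. c k * of_real (flow_eigenvalue n m k) * basis_polygon n k $ j)"
proof -
  let ?N = "polygon_matrix n ^\<^sub>m m"
  let ?\<mu> = "\<lambda>k. - 4 * (sin (pi * real k / real n))\<^sup>2"
  have N: "dim_row ?N = n" "dim_col ?N = n"
    using pow_carrier_mat[OF polygon_matrix_carrier, of n m] by blast+
  have Nv: "(?N *\<^sub>v v) $ j = (\<Sum>i<n. ?N $$ (j, i) * v $ i)" if "v \<in> carrier_vec n" for v
    using that j N by (simp add: scalar_prod_def atLeast0LessThan)
  have "(((-1) ^ (m + 1) \<cdot>\<^sub>m ?N) *\<^sub>v X) $ j = (-1) ^ (m + 1) * (\<Sum>i<n. ?N $$ (j, i) * X $ i)"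
    using N X j by (simp add: scalar_prod_def atLeast0LessThan sum_distrib_left mult.assoc
        sum_negf)
  also have "(\<Sum>i<n. ?N $$ (j, i) * X $ i) =
      (\<Sum>i<n. \<Sum>k<n. c k * (?N $$ (j, i) * basis_polygon n k $ i))"
    by (rule sum.cong) (simp_all add: exp sum_distrib_left mult_ac)
  also have "\<dots> = (\<Sum>k<n. c k * (?N *\<^sub>v basis_polygon n k) $ j)"
    by (subst sum.swap) (simp add: sum_distrib_left Nv)
  also have "\<dots> = (\<Sum>k<n. c k * (of_real (?\<mu> k) ^ m * basis_polygon n k $ j))"
    using j by (simp only: polygon_matrix_pow_eigen[OF n] index_smult_vec basis_polygon_dim)
  finally show ?thesis
    by (simp add: flow_eigenvalue_def sum_distrib_left mult_ac)
qed

text \<open>The sign in front cancels that of the \<open>m\<close>-th power, so no mode grows,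
  whatever the parity of \<open>m\<close>.\<close>

lemma flow_eigenvalue_eq: "flow_eigenvalue n m k = - ((4 * (sin (pi * real k / real n))\<^sup>2) ^ m)"
proof -
  have "(-1) ^ (m + 1) * (- a) ^ m = - (a ^ m)" for a :: real
    by (cases "even m") simp_all
  from this[of "4 * (sin (pi * real k / real n))\<^sup>2"] show ?thesis
    by (simp add: flow_eigenvalue_def)
qed

text \<open>For \<open>m = 0\<close> the value would be \<open>-1\<close>, because
  \<open>0 ^ 0 = 1\<close>.\<close>

lemma flow_eigenvalue_0: "m \<ge> 1 \<Longrightarrow> flow_eigenvalue n m 0 = 0"
  by (simp add: flow_eigenvalue_eq)

text \<open>From \<open>sin (pi - x) = sin x\<close>. Hence the modes 1 and \<open>n - 1\<close>
  decay equally fast, and comparisons of eigenvalues reduce to \<open>2 * k \<le> n\<close>.\<close>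

lemma flow_eigenvalue_reflect:
  assumes "k \<le> n" "n > 0"
  shows "flow_eigenvalue n m (n - k) = flow_eigenvalue n m k"
proof -
  have "pi * real (n - k) / real n = pi - pi * real k / real n"
    using assms by (simp add: of_nat_diff field_simps)
  thus ?thesis by (simp add: flow_eigenvalue_eq)
qed

lemma flow_eigenvalue_1_neg:
  assumes "n \<ge> 2"
  shows "flow_eigenvalue n m 1 < 0"
proof -
  have "sin (pi / real n) > 0"
    using assms by (intro sin_gt_zero) (auto simp: field_simps)
  thus ?thesis by (simp add: flow_eigenvalue_eq)
qed

text \<open>The sine increases strictly up to \<open>pi / 2\<close>, which settles the lower half of
  the frequencies; reflection gives the upper half. Strictness is what makes these modes vanish
  after rescaling.\<close>

lemma flow_eigenvalue_less:
  assumes "m \<ge> 1" "2 \<le> k" "k + 2 \<le> n"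
  shows "flow_eigenvalue n m k < flow_eigenvalue n m 1"
proof -
  have half: "flow_eigenvalue n m l < flow_eigenvalue n m 1" if l: "2 \<le> l" "2 * l \<le> n" for l
  proof -
    have n: "real n > 0" using l by simp
    have "pi / real n < pi * real l / real n"
      using l n by (intro divide_strict_right_mono) auto
    moreover have "pi * real l / real n \<le> pi / 2"
      using l n by (simp add: field_simps flip: of_nat_mult)
    moreover have "pi / real n > 0" using n by simp
    ultimately have "sin (pi / real n) < sin (pi * real l / real n)" "0 < sin (pi / real n)"
      by (intro sin_monotone_2pi sin_gt_zero2; linarith)+
    hence "(sin (pi / real n))\<^sup>2 < (sin (pi * real l / real n))\<^sup>2"
      by (intro power_strict_mono) auto
    thus ?thesis
      using assms by (auto simp: flow_eigenvalue_eq intro!: power_strict_mono)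
  qed
  show ?thesis
  proof (cases "2 * k \<le> n")
    case True thus ?thesis using half assms by simp
  next
    case False
    thus ?thesis using half[of "n - k"] flow_eigenvalue_reflect[of k n m] assms by simp
  qed
qed

lemma flow_eigenvalue_le:
  assumes "m \<ge> 1" "1 \<le> k" "k < n" "n \<ge> 3"
  shows "flow_eigenvalue n m k \<le> flow_eigenvalue n m 1"
proof -
  consider "k = 1" | "k = n - 1" | "2 \<le> k" "k + 2 \<le> n" using assms by linarith
  thus ?thesis
    using flow_eigenvalue_less[of m k n] flow_eigenvalue_reflect[of 1 n m] assms
    by cases auto
qed

section \<open>The flow\<close>

lemma flow_solution_carrier: "flow_solution n m X0 t \<in> carrier_vec n"
  by (simp add: flow_solution_def finsum_basis_polygon_carrier)

text \<open>The separately written constant mode joins the sum because its eigenvalue is 0 and its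
  exponential factor therefore 1.\<close>

lemma flow_solution_index:
  assumes "X0 \<in> carrier_vec n" "m \<ge> 1" "j < n"
  shows "flow_solution n m X0 t $ j =
    (\<Sum>k<n. fourier_coeff n X0 k * of_real (exp (flow_eigenvalue n m k * t)) *
       basis_polygon n k $ j)"
proof -
  let ?f = "\<lambda>k. fourier_coeff n X0 k * of_real (exp (flow_eigenvalue n m k * t)) *
       basis_polygon n k $ j"
  have n: "n > 0" using assms by simp
  have F: "finsum_vec TYPE(complex) n
       (\<lambda>k. (polygon_coeffs n X0 $ k * of_real (exp (flow_eigenvalue n m k * t))) \<cdot>\<^sub>v
            basis_polygon n k) {1..<n} $ j = sum ?f {1..<n}"
    using assms by (auto simp: index_finsum_basis_polygon polygon_coeffs_eq intro!: sum.cong)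
  have "sum ?f {..<n} = ?f 0 + sum ?f {1..<n}"
    using n sum.atLeast_Suc_lessThan[of 0 n ?f] by (simp add: atLeast0LessThan)
  also have "?f 0 = (polygon_coeffs n X0 $ 0 \<cdot>\<^sub>v basis_polygon n 0) $ j"
    using assms n by (simp add: polygon_coeffs_eq flow_eigenvalue_0)
  finally show ?thesis
    using assms(3) F carrier_vecD[OF finsum_basis_polygon_carrier]
    by (simp add: flow_solution_def)
qed

lemma flow_solution_flow:
  assumes n: "n \<ge> 3" and m: "m \<ge> 1" and X0: "X0 \<in> carrier_vec n"
  shows "polygon_flow n m X0 UNIV (flow_solution n m X0)"
  unfolding polygon_flow_def
proof (intro conjI ballI allI impI)
  show "flow_solution n m X0 0 = X0"
    by (rule eq_vecI) (use X0 flow_solution_carrier[of n m X0 0] in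
        \<open>auto simp: flow_solution_index[OF X0 m] fourier_inversion[of _ n X0, symmetric]\<close>)
  fix t :: real and j assume j: "j < n"
  let ?c = "\<lambda>k. fourier_coeff n X0 k * of_real (exp (flow_eigenvalue n m k * t))"
  have "((\<lambda>s. \<Sum>k<n. fourier_coeff n X0 k * of_real (exp (flow_eigenvalue n m k * s)) *
         basis_polygon n k $ j) has_vector_derivative
       (\<Sum>k<n. ?c k * of_real (flow_eigenvalue n m k) * basis_polygon n k $ j)) (at t)"
    by (rule has_vector_derivative_sum)
      (auto intro!: derivative_eq_intros simp: mult_ac)
  thus "((\<lambda>s. flow_solution n m X0 s $ j) has_vector_derivative
          (((-1) ^ (m + 1) \<cdot>\<^sub>m (polygon_matrix n ^\<^sub>m m)) *\<^sub>v flow_solution n m X0 t) $ j) (at t)"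
    by (simp only: flow_solution_index[OF X0 m j] flow_generator_expansion[OF n
          flow_solution_carrier j flow_solution_index[OF X0 m]])
qed (rule flow_solution_carrier)

text \<open>Integrating factor: \<open>exp (- a * t) * f t\<close> has derivative zero on
  \<open>I\<close>, and a connected set of reals is convex, so this product is constant.\<close>

lemma linear_ode_unique:
  fixes f :: "real \<Rightarrow> complex"
  assumes I: "connected I" "0 \<in> I" "t \<in> I"
    and f: "\<And>t. t \<in> I \<Longrightarrow> (f has_vector_derivative of_real a * f t) (at t within I)"
  shows "f t = f 0 * of_real (exp (a * t))"
proof -
  let ?g = "\<lambda>t. of_real (exp (- a * t)) * f t"
  have "convex I" using I by (simp add: connected_convex_1)
  moreover have "(?g has_vector_derivative 0) (at t within I)" if "t \<in> I" for t
    by (rule derivative_eq_intros f that refl)+ (simp add: algebra_simps)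
  ultimately obtain c where "\<And>t. t \<in> I \<Longrightarrow> ?g t = c"
    using has_vector_derivative_zero_constant by blast
  hence "?g t = ?g 0" using I by metis
  thus ?thesis by (simp add: exp_minus field_simps)
qed

text \<open>Each Fourier coefficient of \<open>Y\<close> satisfies a scalar linear equation on
  \<open>I\<close>; inversion recovers \<open>Y\<close>. Allowing any interval around or ending at 0
  covers solutions given only for part of the time.\<close>

lemma polygon_flow_unique:
  assumes n: "n \<ge> 3" and m: "m \<ge> 1" and X0: "X0 \<in> carrier_vec n"
    and I: "connected I" "0 \<in> I" "t \<in> I" and Y: "polygon_flow n m X0 I Y"
  shows "Y t = flow_solution n m X0 t"
proof -
  let ?G = "(-1) ^ (m + 1) \<cdot>\<^sub>m (polygon_matrix n ^\<^sub>m m)"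
  have Y0: "Y 0 = X0" and Yc: "\<And>t. t \<in> I \<Longrightarrow> Y t \<in> carrier_vec n"
    and Yd: "\<And>t j. t \<in> I \<Longrightarrow> j < n \<Longrightarrow>
      ((\<lambda>s. Y s $ j) has_vector_derivative (?G *\<^sub>v Y t) $ j) (at t within I)"
    using Y by (auto simp: polygon_flow_def)
  have coeff: "fourier_coeff n (Y t) k =
      fourier_coeff n X0 k * of_real (exp (flow_eigenvalue n m k * t))" if k: "k < n" for k
  proof -
    have "((\<lambda>s. fourier_coeff n (Y s) k) has_vector_derivative
        of_real (flow_eigenvalue n m k) * fourier_coeff n (Y s) k) (at s within I)"
      if s: "s \<in> I" for s
    proof -
      have "fourier_coeff n (?G *\<^sub>v Y s) k =
          fourier_coeff n (Y s) k * of_real (flow_eigenvalue n m k)"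
        by (rule fourier_coeff_expansion[OF _ k])
          (rule flow_generator_expansion[OF n Yc[OF s] _ fourier_inversion])
      \<comment> \<open>A Fourier coefficient is a fixed finite linear combination of entries, so it
        commutes with differentiation.\<close>
      moreover have "((\<lambda>s. fourier_coeff n (Y s) k) has_vector_derivative
          fourier_coeff n (?G *\<^sub>v Y s) k) (at s within I)"
        unfolding fourier_coeff_def
        by (intro has_vector_derivative_divide has_vector_derivative_sum
            has_vector_derivative_mult_left Yd s) auto
      ultimately show ?thesis by (simp add: mult.commute)
    qed
    from linear_ode_unique[OF I this] show ?thesis by (simp add: Y0)
  qed
  show ?thesis
  proof (rule eq_vecI)
    fix j assume "j < dim_vec (flow_solution n m X0 t)"
    hence j: "j < n" using carrier_vecD[OF flow_solution_carrier] by metis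
    show "Y t $ j = flow_solution n m X0 t $ j"
      unfolding fourier_inversion[OF j, of "Y t"] flow_solution_index[OF X0 m j]
      by (rule sum.cong) (simp_all add: coeff)
  qed (use Yc I carrier_vecD flow_solution_carrier in metis)
qed

section \<open>Asymptotics\<close>

text \<open>The entries of the zeroth basis polygon are all 1, so
  \<open>fourier_coeff n X0 0\<close> is the centroid of \<open>X0\<close>; subtracting it removes
  exactly the stationary mode.\<close>

lemma flow_solution_centered:
  assumes "X0 \<in> carrier_vec n" "m \<ge> 1" "j < n"
  shows "flow_solution n m X0 t $ j - fourier_coeff n X0 0 =
    (\<Sum>k=1..<n. fourier_coeff n X0 k * of_real (exp (flow_eigenvalue n m k * t)) *
       basis_polygon n k $ j)"
proof -
  have "n > 0" using assms by simp
  thus ?thesis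
    using assms(3) sum.atLeast_Suc_lessThan[of 0 n "\<lambda>k. fourier_coeff n X0 k *
        of_real (exp (flow_eigenvalue n m k * t)) * basis_polygon n k $ j"]
    by (simp add: flow_solution_index[OF assms] atLeast0LessThan flow_eigenvalue_0[OF assms(2)]
        basis_polygon_0)
qed

text \<open>Basis entries have modulus 1, and for \<open>t \<ge> 0\<close> every nonconstant mode is
  dominated by the exponential of mode 1.\<close>

lemma flow_solution_decay:
  assumes n: "n \<ge> 3" and m: "m \<ge> 1" and X0: "X0 \<in> carrier_vec n" and j: "j < n" and t: "t \<ge> 0"
  shows "norm (flow_solution n m X0 t $ j - fourier_coeff n X0 0) \<le>
    (\<Sum>k=1..<n. norm (fourier_coeff n X0 k)) * exp (flow_eigenvalue n m 1 * t)"
proof -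
  have "norm (fourier_coeff n X0 k * of_real (exp (flow_eigenvalue n m k * t)) *
       basis_polygon n k $ j) \<le> norm (fourier_coeff n X0 k) * exp (flow_eigenvalue n m 1 * t)"
    if "k \<in> {1..<n}" for k
    using flow_eigenvalue_le[OF m _ _ n, of k] that t
    by (auto simp: norm_mult norm_basis_polygon[OF j] intro!: mult_left_mono mult_right_mono)
  thus ?thesis
    unfolding flow_solution_centered[OF X0 m j] sum_distrib_right by (rule sum_norm_le)
qed

lemma basis_polygon_last:
  assumes "j < n"
  shows "basis_polygon n (n - 1) $ j = cnj (basis_polygon n 1 $ j)"
proof -
  have "2 * pi * real (n - 1) / real n = 2 * pi - 2 * pi / real n"
    using assms by (simp add: of_nat_diff field_simps)
  hence "cis (2 * pi * real (n - 1) / real n) = cis (- (2 * pi / real n))"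
    by (simp add: complex_eq_iff)
  thus ?thesis using assms by (simp add: basis_polygon_index flip: cis_cnj complex_cnj_power)
qed

text \<open>Rescaling leaves mode \<open>k\<close> with the exponent
  \<open>(?l k - ?l 1) * t\<close>, which is 0 for \<open>k = 1\<close> and \<open>k = n - 1\<close>
  and tends to minus infinity for the other nonconstant modes.\<close>

lemma flow_solution_rescaled_limit:
  assumes n: "n \<ge> 3" and m: "m \<ge> 1" and X0: "X0 \<in> carrier_vec n" and j: "j < n"
  shows "((\<lambda>t. exp (- flow_eigenvalue n m 1 * t) *\<^sub>R
      (flow_solution n m X0 t $ j - fourier_coeff n X0 0)) \<longlongrightarrow>
    fourier_coeff n X0 1 * basis_polygon n 1 $ j +
    fourier_coeff n X0 (n - 1) * cnj (basis_polygon n 1 $ j)) at_top"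
proof -
  let ?l = "flow_eigenvalue n m"
  let ?a = "\<lambda>k. fourier_coeff n X0 k * basis_polygon n k $ j"
  have eq: "exp (- ?l 1 * t) *\<^sub>R (flow_solution n m X0 t $ j - fourier_coeff n X0 0) =
      (\<Sum>k=1..<n. ?a k * of_real (exp ((?l k - ?l 1) * t)))" for t
  proof -
    have "exp ((?l k - ?l 1) * t) = exp (- ?l 1 * t) * exp (?l k * t)" for k
      by (simp add: algebra_simps flip: exp_add)
    thus ?thesis
      by (simp add: flow_solution_centered[OF X0 m j] scaleR_conv_of_real sum_distrib_left mult_ac)
  qed
  have "((\<lambda>t. ?a k * of_real (exp ((?l k - ?l 1) * t))) \<longlongrightarrow>
      (if k = 1 \<or> k = n - 1 then ?a k else 0)) at_top" if k: "k \<in> {1..<n}" for k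
  proof (cases "k = 1 \<or> k = n - 1")
    case True
    hence "?l k = ?l 1" using flow_eigenvalue_reflect[of 1 n m] n by auto
    thus ?thesis using True by simp
  next
    case False
    hence "?l k - ?l 1 < 0" using flow_eigenvalue_less[OF m, of k n] k by auto
    hence "filterlim (\<lambda>t. (?l k - ?l 1) * t) at_bot at_top"
      by (intro filterlim_tendsto_neg_mult_at_bot[OF tendsto_const] filterlim_ident)
    hence "((\<lambda>t. exp ((?l k - ?l 1) * t)) \<longlongrightarrow> 0) at_top"
      by (rule filterlim_compose[OF exp_at_bot])
    hence "((\<lambda>t. ?a k * of_real (exp ((?l k - ?l 1) * t))) \<longlongrightarrow> ?a k * of_real 0) at_top"
      by (intro tendsto_intros)
    thus ?thesis using False by simp
  qed
  hence "((\<lambda>t. \<Sum>k=1..<n. ?a k * of_real (exp ((?l k - ?l 1) * t))) \<longlongrightarrow>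
      (\<Sum>k=1..<n. if k = 1 \<or> k = n - 1 then ?a k else 0)) at_top"
    by (rule tendsto_sum)
  also have "(\<Sum>k=1..<n. if k = 1 \<or> k = n - 1 then ?a k else 0) = sum ?a {1, n - 1}"
    by (rule sum.mono_neutral_cong_right) (use n in auto)
  \<comment> \<open>Here \<open>n \<ge> 3\<close> ensures that 1 and \<open>n - 1\<close> differ, so
    neither term is counted twice.\<close>
  also have "\<dots> = ?a 1 + ?a (n - 1)" using n by simp
  finally show ?thesis unfolding eq by (simp only: basis_polygon_last[OF j])
qed

lemma regular_basis_polygon: "regular_polygon n (basis_polygon n 1)"
  unfolding regular_polygon_def
  by (intro conjI exI[of _ "0 :: complex"] exI[of _ "1 :: complex"] exI[of _ "1 :: real"])
    (auto simp: basis_polygon_index DeMoivre mult_ac)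

lemma linear_mult_cnj: "linear (\<lambda>z. a * z + b * cnj z)"
  by (rule linearI) (simp_all add: algebra_simps scaleR_conv_of_real)

text \<open>A constant map of this form is zero; its values at 1 and at \<open>\<i>\<close> then
  give \<open>a + b = 0\<close> and \<open>a - b = 0\<close>. So the limit map is not constant once
  one of the slowest modes is present.\<close>

lemma mult_cnj_not_constant:
  assumes "a \<noteq> 0 \<or> b \<noteq> 0"
  shows "\<exists>z w. a * z + b * cnj z \<noteq> a * w + b * cnj w"
proof (rule ccontr)
  assume "\<not> ?thesis"
  hence "a * z + b * cnj z = a * 0 + b * cnj 0" for z by blast
  hence *: "a * z + b * cnj z = 0" for z by simp
  have "a + b = 0" using *[of 1] by simp
  moreover have "a - b = 0" using *[of \<i>] by (simp flip: left_diff_distrib)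
  ultimately show False using assms by (simp add: eq_neg_iff_add_eq_0 [symmetric])
qed

text \<open>On the kernel the two summands have equal norm, which forces \<open>z = 0\<close> when
  \<open>a\<close> and \<open>b\<close> differ in norm. In finite dimension, injectivity of a linear
  endomorphism gives surjectivity.\<close>

lemma bij_mult_cnj:
  assumes "norm a \<noteq> norm b"
  shows "bij (\<lambda>z. a * z + b * cnj z)"
proof -
  let ?L = "\<lambda>z. a * z + b * cnj z"
  have "z = 0" if "?L z = 0" for z
  proof -
    have "norm (a * z) = norm (b * cnj z)" using that by (metis add_eq_0_iff norm_minus_cancel)
    thus ?thesis using assms by (simp add: norm_mult)
  qed
  hence "inj ?L" using linear_injective_0[OF linear_mult_cnj] by blast
  thus ?thesis using linear_injective_imp_surjective[OF linear_mult_cnj] by (simp add: bij_def)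
qed

theorem theorem4p4:
  fixes n m :: nat and X0 :: polygon
  assumes "n \<ge> 3" and "m \<ge> 1" and "X0 \<in> carrier_vec n"
  shows "polygon_flow n m X0 UNIV (flow_solution n m X0)
    \<and> (\<forall>I Y. connected I \<and> 0 \<in> I \<and> polygon_flow n m X0 I Y \<longrightarrow>
         (\<forall>t\<in>I. Y t = flow_solution n m X0 t))
    \<and> (\<exists>p :: complex.
         (\<exists>C \<delta>. \<delta> > 0 \<and>
            (\<forall>t\<ge>0. \<forall>j<n. norm (flow_solution n m X0 t $ j - p) \<le> C * exp (- \<delta> * t)))
       \<and> (\<exists>A R. affine_transformation A \<and> regular_polygon n R
            \<and> (\<forall>j<n. ((\<lambda>t. exp (- flow_eigenvalue n m 1 * t) *\<^sub>R (flow_solution n m X0 t $ j - p))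
                  \<longlongrightarrow> A (R $ j)) at_top)
            \<and> (polygon_coeffs n X0 $ 1 \<noteq> 0 \<or> polygon_coeffs n X0 $ (n - 1) \<noteq> 0 \<longrightarrow>
                 (\<exists>z w. A z \<noteq> A w))
            \<and> (norm (polygon_coeffs n X0 $ 1) \<noteq> norm (polygon_coeffs n X0 $ (n - 1)) \<longrightarrow>
                 bij A)))"
proof -
  let ?a = "polygon_coeffs n X0 $ 1" and ?b = "polygon_coeffs n X0 $ (n - 1)"
  let ?A = "\<lambda>z. ?a * z + ?b * cnj z"
  have a: "?a = fourier_coeff n X0 1" and b: "?b = fourier_coeff n X0 (n - 1)"
    using assms by (simp_all add: polygon_coeffs_eq)
  have "affine_transformation ?A"
    unfolding affine_transformation_def using linear_mult_cnj[of ?a ?b]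
    by (intro exI[of _ ?A] exI[of _ 0]) simp
  moreover have "\<forall>j<n. ((\<lambda>t. exp (- flow_eigenvalue n m 1 * t) *\<^sub>R
      (flow_solution n m X0 t $ j - fourier_coeff n X0 0)) \<longlongrightarrow> ?A (basis_polygon n 1 $ j)) at_top"
    unfolding a b using flow_solution_rescaled_limit[OF assms] by blast
  ultimately have "\<exists>A R. affine_transformation A \<and> regular_polygon n R
      \<and> (\<forall>j<n. ((\<lambda>t. exp (- flow_eigenvalue n m 1 * t) *\<^sub>R
          (flow_solution n m X0 t $ j - fourier_coeff n X0 0)) \<longlongrightarrow> A (R $ j)) at_top)
      \<and> (?a \<noteq> 0 \<or> ?b \<noteq> 0 \<longrightarrow> (\<exists>z w. A z \<noteq> A w)) \<and> (norm ?a \<noteq> norm ?b \<longrightarrow> bij A)"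
    using regular_basis_polygon[of n] mult_cnj_not_constant[of ?a ?b] bij_mult_cnj[of ?a ?b]
    by (intro exI[of _ ?A] exI[of _ "basis_polygon n 1"] conjI impI)
  moreover have "\<exists>C \<delta>. \<delta> > 0 \<and> (\<forall>t\<ge>0. \<forall>j<n.
      norm (flow_solution n m X0 t $ j - fourier_coeff n X0 0) \<le> C * exp (- \<delta> * t))"
    using flow_solution_decay[OF assms] flow_eigenvalue_1_neg[of n m] assms(1)
    \<comment> \<open>The rate is the spectral gap \<open>- flow_eigenvalue n m 1\<close>, positive
      by \<open>flow_eigenvalue_1_neg\<close>.\<close>
    by (intro exI[of _ "\<Sum>k=1..<n. norm (fourier_coeff n X0 k)"]
        exI[of _ "- flow_eigenvalue n m 1"]) simp
  \<comment> \<open>The point \<open>p\<close> is the centroid \<open>fourier_coeff n X0 0\<close>,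
    common to the decay bound and the rescaled limit.\<close>
  ultimately show ?thesis
    using flow_solution_flow[OF assms] polygon_flow_unique[OF assms] by blast
qed

end
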